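(* Let $V = \bigoplus_{i \in \mathbb{N}} \mathbb{F}_2 e_i$ be the countable-dimensional vector space over $\mathbb{F}_2$ with basis $\{e_i\}_{i \in \mathbb{N}}$. Let $U = \{u \in \operatorname{GL}(V) : \text{for every } i \in \mathbb{N},\ u(e_i) = e_i + \sum_{j < i} c_{ij} e_j \text{ with } c_{ij} \in \mathbb{F}_2\}$. Let $G = V \rtimes U$ with multiplication $(v,u)(w,s) = (v + u(w),\, us)$. Let $A = \{(e_i, 1) : i \in \mathbb{N}\}$ and $B = \{(v,1) : v \in V \setminus (\{0\} \cup \{e_i : i \in \mathbb{N}\})\}$. Then: (1) $U$ is a group, $|U| = 2^{\aleph_0}$, and $|G| = 2^{\aleph_0}$; (2) $A \cap B = \varnothing$, and $|A| = |B| = \aleph_0 < |G|$; (3) $W_G(A,B) = V \times \{1\}$, so $|W_G(A,B)| = \aleph_0$; (4) any set $X \subset G$ containing the identity $e = (0,1)$ of $G$ and satisfying $X = X^{-1}$ and $XAX \cap B = \varnothing$ must be $\{e\}$, so $A$ and $B$ are not separable in $G$.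
   Context: Here $1$ denotes the identity of $U$ and $e = (0,1)$ the identity of $G$. For disjoint subsets $A, B$ of an infinite group $G$ with identity $e$: $A$ and $B$ are separable in $G$ if there exists a subset $X \subset G$ such that (1) $X$ is infinite; (2) $e \in X$; (3) $X = X^{-1}$, i.e. $x \in X \Rightarrow x^{-1} \in X$; (4) $XAX \cap B = \varnothing$, where $XAX = \{x a x' : x, x' \in X,\ a \in A\}$. Moreover $W_G(A,B) := \{u \in G : \{u,u^{-1}\}\, A\, \{u,u^{-1}\} \cap B = \varnothing\}$, i.e. $u \in W_G(A,B)$ if and only if $uAu$, $uAu^{-1}$, $u^{-1}Au$, $u^{-1}Au^{-1}$ are all disjoint from $B$. *)

theory Defs
  imports
    Complex_Main
    "HOL-Library.Z2"
    "HOL-Library.Poly_Mapping"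
    "HOL-Library.Equipollence"
    "HOL-Algebra.Coset"
begin

text \<open>
  Separability is meant for disjoint subsets \<open>A\<close>, \<open>B\<close> of the carrier of an infinite group \<open>G\<close>;
  these side conditions are not part of the definition.
\<close>

definition separable :: "('g, 'm) monoid_scheme \<Rightarrow> 'g set \<Rightarrow> 'g set \<Rightarrow> bool" where
  "separable G A B \<longleftrightarrow>
    (\<exists>X \<subseteq> carrier G. infinite X \<and> \<one>\<^bsub>G\<^esub> \<in> X \<and> X = set_inv\<^bsub>G\<^esub> X \<and>
       (X <#>\<^bsub>G\<^esub> A <#>\<^bsub>G\<^esub> X) \<inter> B = {})"

definition W_set :: "('g, 'm) monoid_scheme \<Rightarrow> 'g set \<Rightarrow> 'g set \<Rightarrow> 'g set" where
  "W_set G A B =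
    {u \<in> carrier G. ({u, inv\<^bsub>G\<^esub> u} <#>\<^bsub>G\<^esub> A <#>\<^bsub>G\<^esub> {u, inv\<^bsub>G\<^esub> u}) \<inter> B = {}}"

text \<open>
  Finitely supported functions from \<open>nat\<close> into the two-element field \<open>bit\<close> form the direct sum
  of countably many copies of that field.
\<close>

type_synonym V = "nat \<Rightarrow>\<^sub>0 bit"

definition scale_V :: "bit \<Rightarrow> V \<Rightarrow> V" where
  "scale_V c v = Poly_Mapping.map (\<lambda>x. c * x) v"

definition basis_V :: "nat \<Rightarrow> V" where
  "basis_V i = Poly_Mapping.single i 1"

lemma lookup_scale_V: "Poly_Mapping.lookup (scale_V c v) k = c * Poly_Mapping.lookup v k"
  unfolding scale_V_def by transfer (simp add: when_def)

interpretation V: vector_space scale_V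
  by unfold_locales
    (rule poly_mapping_eqI, simp only: lookup_scale_V lookup_add distrib_left distrib_right
      mult.assoc mult_1_left)+

definition GL_V :: "(V \<Rightarrow> V) set" where
  "GL_V = {u. Vector_Spaces.linear scale_V scale_V u \<and> bij u}"

definition U_grp :: "(V \<Rightarrow> V) monoid" where
  "U_grp =
    \<lparr>carrier = {u \<in> GL_V. \<forall>i. \<exists>c :: nat \<Rightarrow> bit.
        u (basis_V i) = basis_V i + (\<Sum>j<i. scale_V (c j) (basis_V j))},
     mult = (\<lambda>u s. u \<circ> s),
     one = id\<rparr>"

definition G_grp :: "(V \<times> (V \<Rightarrow> V)) monoid" where
  "G_grp =
    \<lparr>carrier = UNIV \<times> carrier U_grp,
     mult = (\<lambda>(v, u) (w, s). (v + u w, u \<otimes>\<^bsub>U_grp\<^esub> s)),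
     one = (0, \<one>\<^bsub>U_grp\<^esub>)\<rparr>"

text \<open>The semidirect product is a group as soon as \<open>U_grp\<close> is one.\<close>

lemma group_G_grp:
  assumes "group U_grp"
  shows "group G_grp"
proof -
  interpret U: group U_grp by (rule assms)
  have lin: "Vector_Spaces.linear scale_V scale_V u" if "u \<in> carrier U_grp" for u
    using that by (simp add: U_grp_def GL_V_def)
  have add: "u (v + w) = u v + u w" if "u \<in> carrier U_grp" for u v w
    using lin[OF that] unfolding Vector_Spaces.linear_def by (blast intro: module_hom.add)
  have comp: "(u \<otimes>\<^bsub>U_grp\<^esub> s) w = u (s w)" and one: "\<one>\<^bsub>U_grp\<^esub> w = w" for u s w
    by (simp_all add: U_grp_def)
  show ?thesis
  proof (rule groupI)
    fix x assume "x \<in> carrier G_grp"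
    then obtain v u where x: "x = (v, u)" and u: "u \<in> carrier U_grp"
      by (auto simp: G_grp_def)
    let ?i = "inv\<^bsub>U_grp\<^esub> u"
    have "(- ?i v, ?i) \<in> carrier G_grp" "(- ?i v, ?i) \<otimes>\<^bsub>G_grp\<^esub> x = \<one>\<^bsub>G_grp\<^esub>"
      using u by (simp_all add: x G_grp_def)
    then show "\<exists>y\<in>carrier G_grp. y \<otimes>\<^bsub>G_grp\<^esub> x = \<one>\<^bsub>G_grp\<^esub>" ..
  qed (auto simp: G_grp_def U.m_assoc add comp one add.assoc)
qed

definition A_set :: "(V \<times> (V \<Rightarrow> V)) set" where
  "A_set = {(basis_V i, \<one>\<^bsub>U_grp\<^esub>) | i. True}"

definition B_set :: "(V \<times> (V \<Rightarrow> V)) set" where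
  "B_set = {(v, \<one>\<^bsub>U_grp\<^esub>) | v. v \<notin> {0} \<union> {basis_V i | i. True}}"

end

theory Submission
  imports Defs
begin

text \<open>
  Since \<open>A\<close> and \<open>B\<close> lie in the normal subgroup \<open>V \<times> {1}\<close>, conjugating an element of \<open>A\<close> by
  \<open>(v, u)\<close> merely applies \<open>u\<close> to it, so an element of \<open>W\<^sub>G(A, B)\<close> has a second component that
  sends every \<open>e\<^sub>i\<close> to some basis vector. As \<open>u e\<^sub>i\<close> also has a
  nonzero \<open>i\<close>-th coordinate, \<open>u\<close> fixes every \<open>e\<^sub>i\<close> and is the identity (lemma
  \<open>unitriangular_basis_preserving_imp_id\<close>). Conversely, in characteristic two the elements
  \<open>(v, 1)\<close> are involutions commuting with \<open>A\<close>, so they multiply \<open>A\<close> from both sides into \<open>A\<close>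
  itself. This determines \<open>W\<^sub>G(A, B)\<close>.

  A symmetric set \<open>X\<close> with \<open>XAX\<close> disjoint from \<open>B\<close> lies in \<open>W\<^sub>G(A, B) = V \<times> {1}\<close>. If it also contains
  the identity, then \<open>(v, 1) \<in> X\<close> forces every \<open>e\<^sub>i + v\<close> to be zero or a basis vector. For \<open>v \<noteq> 0\<close>
  this fails at any \<open>i\<close> outside the support of \<open>v\<close>, because \<open>e\<^sub>i + v\<close> then has at least two nonzero
  coordinates (lemma \<open>ex_basis_translate_outside\<close>). Hence \<open>X\<close> is trivial.

  The group property of \<open>U\<close> is most transparent without a basis: with \<open>V\<^sub>n\<close> the span of the first
  \<open>n\<close> basis vectors, \<open>u\<close> belongs to \<open>U\<close> iff it is an automorphism and \<open>u - 1\<close> maps \<open>V\<^sub>n\<^sub>+\<^sub>1\<close> into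
  \<open>V\<^sub>n\<close> for all \<open>n\<close> (lemma \<open>carrier_U_iff\<close>), a condition visibly stable under products and
  inverses. Cardinalities: an element of \<open>G\<close> is a sequence in the countable set \<open>V\<close>, namely its
  translation part followed by the images of the basis vectors, whereas the block-diagonal matrices
  with \<open>2 \<times> 2\<close> unitriangular blocks already give an element of \<open>U\<close> for each set of naturals.
\<close>

section \<open>Vectors over the two-element field\<close>

lemma add_self_V [simp]: "v + v = (0 :: V)"
  by (rule poly_mapping_eqI) (simp only: lookup_add lookup_zero, simp)

lemma lookup_basis_V: "Poly_Mapping.lookup (basis_V i) k = (if k = i then 1 else 0)"
  by (simp add: basis_V_def lookup_single when_def)

lemma inj_basis_V: "inj basis_V"
proof (rule injI)
  fix i j assume "basis_V i = basis_V j"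
  then have "Poly_Mapping.lookup (basis_V i) i = Poly_Mapping.lookup (basis_V j) i"
    by simp
  then show "i = j"
    by (simp add: lookup_basis_V split: if_splits)
qed

lemma two_coordinates_not_basis_V:
  assumes "Poly_Mapping.lookup v i \<noteq> 0" and "Poly_Mapping.lookup v j \<noteq> 0" and "i \<noteq> j"
  shows "v \<notin> {0} \<union> {basis_V k | k. True}"
  using assms by (auto simp: lookup_basis_V split: if_splits)

text \<open>An index outside the finite support of \<open>v\<close> is a suitable \<open>i\<close>.\<close>

lemma ex_basis_translate_outside:
  assumes "v \<noteq> 0"
  shows "\<exists>i. basis_V i + v \<notin> {0} \<union> {basis_V k | k. True}"
proof -
  obtain j where j: "Poly_Mapping.lookup v j \<noteq> 0"
    using assms by (metis lookup_zero poly_mapping_eqI)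
  obtain i where i: "i \<notin> Poly_Mapping.keys v"
    using ex_new_if_finite[OF infinite_UNIV_nat finite_keys] by blast
  then have "Poly_Mapping.lookup v i = 0"
    by (simp add: in_keys_iff)
  with j have "i \<noteq> j"
    by auto
  with i j have "basis_V i + v \<notin> {0} \<union> {basis_V k | k. True}"
    by (intro two_coordinates_not_basis_V[of _ i j])
      (auto simp: lookup_add lookup_basis_V in_keys_iff)
  then show ?thesis ..
qed

text \<open>A vector over the two-element field is determined by its support, a finite set of naturals.\<close>

lemma inj_set_encode_keys: "inj (\<lambda>v :: V. set_encode (Poly_Mapping.keys v))"
proof (rule injI, rule poly_mapping_eqI)
  fix v w :: V and k
  assume "set_encode (Poly_Mapping.keys v) = set_encode (Poly_Mapping.keys w)"
  then have "k \<in> Poly_Mapping.keys v \<longleftrightarrow> k \<in> Poly_Mapping.keys w"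
    by (simp add: set_encode_eq)
  then show "Poly_Mapping.lookup v k = Poly_Mapping.lookup w k"
    by (cases "Poly_Mapping.lookup v k"; cases "Poly_Mapping.lookup w k")
      (simp_all add: in_keys_iff)
qed

lemma V_eqpoll_nat: "(UNIV :: V set) \<approx> (UNIV :: nat set)"
proof (rule lepoll_antisym)
  show "(UNIV :: V set) \<lesssim> (UNIV :: nat set)"
    unfolding lepoll_def using inj_set_encode_keys by blast
  show "(UNIV :: nat set) \<lesssim> (UNIV :: V set)"
    unfolding lepoll_def using inj_basis_V by blast
qed

section \<open>The standard flag and unitriangular maps\<close>

definition flag :: "nat \<Rightarrow> V set" where
  "flag n = {v. \<forall>k\<ge>n. Poly_Mapping.lookup v k = 0}"

lemma flag_mono: "m \<le> n \<Longrightarrow> flag m \<subseteq> flag n"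
  by (auto simp: flag_def)

lemma subspace_flag: "V.subspace (flag n)"
  by (auto simp: V.subspace_def flag_def lookup_add lookup_scale_V)

lemma basis_V_in_flag: "basis_V i \<in> flag (Suc i)"
  by (auto simp: flag_def lookup_basis_V)

lemma flag_zero: "v \<in> flag 0 \<Longrightarrow> v = 0"
  by (rule poly_mapping_eqI) (simp add: flag_def)

lemma ex_flag: "\<exists>n. v \<in> flag n"
proof -
  obtain n where "\<forall>k\<in>Poly_Mapping.keys v. k < n"
    using finite_nat_set_iff_bounded[THEN iffD1, OF finite_keys] by blast
  then have "k \<notin> Poly_Mapping.keys v" if "n \<le> k" for k
    using that by (auto simp: linorder_not_less[symmetric])
  then have "v \<in> flag n"
    unfolding flag_def in_keys_iff by blast
  then show ?thesis ..
qed

lemma flag_expansion: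
  assumes "v \<in> flag n"
  shows "v = (\<Sum>j<n. scale_V (Poly_Mapping.lookup v j) (basis_V j))"
proof (rule poly_mapping_eqI)
  fix k
  have "(\<Sum>j<n. Poly_Mapping.lookup v j * (if k = j then 1 else 0)) =
      (\<Sum>j<n. if k = j then Poly_Mapping.lookup v j else 0)"
    by (rule sum.cong) auto
  also have "\<dots> = Poly_Mapping.lookup v k"
    using assms by (simp add: flag_def)
  finally show "Poly_Mapping.lookup v k =
      Poly_Mapping.lookup (\<Sum>j<n. scale_V (Poly_Mapping.lookup v j) (basis_V j)) k"
    by (simp only: lookup_sum lookup_scale_V lookup_basis_V)
qed

lemma sum_basis_V_in_flag: "(\<Sum>j<n. scale_V (c j) (basis_V j)) \<in> flag n"
proof (intro V.subspace_sum[OF subspace_flag] V.subspace_scale[OF subspace_flag])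
  fix j assume "j \<in> {..<n}"
  then show "basis_V j \<in> flag n"
    using basis_V_in_flag[of j] flag_mono[of "Suc j" n] by auto
qed

lemma module_hom_expansion:
  assumes "module_hom scale_V scale_V u" and v: "v \<in> flag n"
  shows "u v = (\<Sum>j<n. scale_V (Poly_Mapping.lookup v j) (u (basis_V j)))"
proof -
  interpret u: module_hom scale_V scale_V u
    by (rule assms)
  have "u v = u (\<Sum>j<n. scale_V (Poly_Mapping.lookup v j) (basis_V j))"
    using flag_expansion[OF v] by (rule arg_cong)
  also have "\<dots> = (\<Sum>j<n. scale_V (Poly_Mapping.lookup v j) (u (basis_V j)))"
    by (simp only: u.sum u.scale)
  finally show ?thesis .
qed

definition unitriangular :: "(V \<Rightarrow> V) \<Rightarrow> bool" where
  "unitriangular u \<longleftrightarrow> (\<forall>n. \<forall>v\<in>flag (Suc n). u v - v \<in> flag n)"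

lemma unitriangularD: "unitriangular u \<Longrightarrow> v \<in> flag (Suc n) \<Longrightarrow> u v - v \<in> flag n"
  unfolding unitriangular_def by blast

lemma unitriangular_flag:
  assumes u: "unitriangular u" "u 0 = 0" and v: "v \<in> flag n"
  shows "u v \<in> flag n"
proof (cases n)
  case 0
  with v have "v = 0"
    by (simp add: flag_zero)
  with u v show ?thesis by simp
next
  case (Suc m)
  then have "u v - v \<in> flag n"
    using unitriangularD[OF u(1), of v m] v flag_mono[of m n] by auto
  from V.subspace_add[OF subspace_flag this v] show ?thesis
    by simp
qed

lemma linear_V_iff:
  "Vector_Spaces.linear scale_V scale_V u \<longleftrightarrow>
    (\<forall>v w. u (v + w) = u v + u w) \<and> (\<forall>c v. u (scale_V c v) = scale_V c (u v))"
  by (simp add: Vector_Spaces.linear_iff V.vector_space_axioms)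

lemma unitriangular_iff_basis:
  assumes lin: "Vector_Spaces.linear scale_V scale_V u"
  shows "unitriangular u \<longleftrightarrow>
    (\<forall>i. \<exists>c. u (basis_V i) = basis_V i + (\<Sum>j<i. scale_V (c j) (basis_V j)))"
proof
  assume u: "unitriangular u"
  show "\<forall>i. \<exists>c. u (basis_V i) = basis_V i + (\<Sum>j<i. scale_V (c j) (basis_V j))"
  proof
    fix i
    have "u (basis_V i) - basis_V i \<in> flag i"
      by (rule unitriangularD[OF u basis_V_in_flag])
    from diff_eq_eq[THEN iffD1, OF flag_expansion[OF this]]
    have "u (basis_V i) = basis_V i + (\<Sum>j<i. scale_V
        (Poly_Mapping.lookup (u (basis_V i) - basis_V i) j) (basis_V j))"
      by (rule trans) (rule add.commute)
    then show "\<exists>c. u (basis_V i) = basis_V i + (\<Sum>j<i. scale_V (c j) (basis_V j))"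
      by (rule exI[of _ "Poly_Mapping.lookup (u (basis_V i) - basis_V i)"])
  qed
next
  interpret u: module_hom scale_V scale_V u
    using lin by (simp add: module_hom_iff_linear)
  assume basis: "\<forall>i. \<exists>c. u (basis_V i) = basis_V i + (\<Sum>j<i. scale_V (c j) (basis_V j))"
  have diff: "u (basis_V i) - basis_V i \<in> flag i" for i
  proof -
    obtain c where "u (basis_V i) = basis_V i + (\<Sum>j<i. scale_V (c j) (basis_V j))"
      using basis by blast
    then show ?thesis
      by (simp only: add_diff_cancel_left' sum_basis_V_in_flag)
  qed
  show "unitriangular u"
    unfolding unitriangular_def
  proof (intro allI ballI)
    fix n v assume v: "v \<in> flag (Suc n)"
    let ?c = "Poly_Mapping.lookup v"
    have "u v - v = (\<Sum>j<Suc n. scale_V (?c j) (u (basis_V j))) -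
        (\<Sum>j<Suc n. scale_V (?c j) (basis_V j))"
      using module_hom_expansion[OF u.module_hom_axioms v] flag_expansion[OF v]
      by (rule arg_cong2[where f = minus])
    also have "\<dots> = (\<Sum>j<Suc n. scale_V (?c j) (u (basis_V j) - basis_V j))"
      by (simp only: sum_subtractf V.scale_right_diff_distrib)
    also have "\<dots> \<in> flag n"
    proof (intro V.subspace_sum[OF subspace_flag] V.subspace_scale[OF subspace_flag])
      fix j assume "j \<in> {..<Suc n}"
      then show "u (basis_V j) - basis_V j \<in> flag n"
        using diff[of j] flag_mono[of j n] by auto
    qed
    finally show "u v - v \<in> flag n" .
  qed
qed

text \<open>The description of \<open>U\<close> through the flag, from which all closure properties are read off.\<close>

lemma carrier_U_iff:
  "u \<in> carrier U_grp \<longleftrightarrow>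
    Vector_Spaces.linear scale_V scale_V u \<and> bij u \<and> unitriangular u"
  using unitriangular_iff_basis[of u] by (simp add: U_grp_def GL_V_def) blast

lemma carrier_U_module_hom:
  "u \<in> carrier U_grp \<Longrightarrow> module_hom scale_V scale_V u"
  by (simp add: carrier_U_iff module_hom_iff_linear)

section \<open>The group of unitriangular automorphisms\<close>

lemma one_U [simp]: "\<one>\<^bsub>U_grp\<^esub> = id"
  and mult_U [simp]: "u \<otimes>\<^bsub>U_grp\<^esub> s = u \<circ> s"
  by (simp_all add: U_grp_def)

lemma id_in_U: "id \<in> carrier U_grp"
  by (simp add: carrier_U_iff V.linear_id unitriangular_def V.subspace_0[OF subspace_flag])

text \<open>With \<open>u = 1 + N\<close>, this rests on \<open>u s - 1 = N s + (s - 1)\<close>.\<close>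

lemma comp_in_U:
  assumes u: "u \<in> carrier U_grp" and s: "s \<in> carrier U_grp"
  shows "u \<circ> s \<in> carrier U_grp"
proof -
  interpret s: module_hom scale_V scale_V s
    by (rule carrier_U_module_hom[OF s])
  have u_tri: "unitriangular u" and s_tri: "unitriangular s"
    using u s by (simp_all add: carrier_U_iff)
  have "unitriangular (u \<circ> s)"
    unfolding unitriangular_def
  proof (intro allI ballI)
    fix n v assume v: "v \<in> flag (Suc n)"
    have "u (s v) - s v \<in> flag n"
      by (rule unitriangularD[OF u_tri unitriangular_flag[OF s_tri s.zero v]])
    from V.subspace_add[OF subspace_flag this unitriangularD[OF s_tri v]]
    show "(u \<circ> s) v - v \<in> flag n"
      by (simp only: o_apply add_diff_eq diff_add_cancel)
  qed
  then show ?thesis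
    using u s by (simp add: carrier_U_iff linear_V_iff bij_comp)
qed

text \<open>
  Applying \<open>u\<^sup>-\<^sup>1\<close> to \<open>u v - v \<in> V\<^sub>n\<close> shows by induction on \<open>n\<close> that \<open>u\<^sup>-\<^sup>1\<close> preserves
  the flag. Then \<open>u\<^sup>-\<^sup>1 v - v\<close> is, up to sign, \<open>u w - w\<close> for \<open>w = u\<^sup>-\<^sup>1 v\<close>.
\<close>

lemma inv_in_U:
  assumes u: "u \<in> carrier U_grp"
  shows "inv_into UNIV u \<in> carrier U_grp"
proof -
  interpret u: module_hom scale_V scale_V u
    by (rule carrier_U_module_hom[OF u])
  have bij: "bij u" and tri: "unitriangular u"
    using u by (simp_all add: carrier_U_iff)
  note [simp] = inv_f_f[OF bij_is_inj[OF bij]] surj_f_inv_f[OF bij_is_surj[OF bij]]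
  have add: "inv_into UNIV u (v + w) = inv_into UNIV u v + inv_into UNIV u w" for v w
    by (rule injD[OF bij_is_inj[OF bij]]) (simp add: u.add)
  have scale: "inv_into UNIV u (scale_V c v) = scale_V c (inv_into UNIV u v)" for c v
    by (rule injD[OF bij_is_inj[OF bij]]) (simp add: u.scale)
  have lin: "Vector_Spaces.linear scale_V scale_V (inv_into UNIV u)"
    by (simp add: linear_V_iff add scale)
  then interpret i: module_hom scale_V scale_V "inv_into UNIV u"
    by (simp add: module_hom_iff_linear)
  have flag: "v \<in> flag n \<Longrightarrow> inv_into UNIV u v \<in> flag n" for n v
  proof (induction n arbitrary: v)
    case 0
    then have "v = 0"
      by (simp add: flag_zero)
    with 0 show ?case
      by (simp add: i.zero)
  next
    case (Suc n)
    then have "inv_into UNIV u (u v - v) \<in> flag n"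
      by (intro Suc.IH unitriangularD[OF tri])
    then have "v - inv_into UNIV u v \<in> flag (Suc n)"
      using flag_mono[of n "Suc n"] by (auto simp: i.diff)
    from V.subspace_diff[OF subspace_flag Suc.prems this] show ?case
      by (simp only: diff_diff_eq2 add_diff_cancel_left')
  qed
  have "unitriangular (inv_into UNIV u)"
    unfolding unitriangular_def
  proof (intro allI ballI)
    fix n v assume v: "v \<in> flag (Suc n)"
    have "u (inv_into UNIV u v) - inv_into UNIV u v \<in> flag n"
      by (rule unitriangularD[OF tri flag[OF v]])
    from V.subspace_neg[OF subspace_flag this] show "inv_into UNIV u v - v \<in> flag n"
      by simp
  qed
  with lin bij show ?thesis
    by (simp add: carrier_U_iff bij_imp_bij_inv)
qed

lemma group_U: "group U_grp"
proof (rule groupI)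
  fix u assume u: "u \<in> carrier U_grp"
  then have "inv_into UNIV u \<otimes>\<^bsub>U_grp\<^esub> u = \<one>\<^bsub>U_grp\<^esub>"
    by (simp add: carrier_U_iff bij_is_inj)
  then show "\<exists>y\<in>carrier U_grp. y \<otimes>\<^bsub>U_grp\<^esub> u = \<one>\<^bsub>U_grp\<^esub>"
    by (rule bexI[OF _ inv_in_U[OF u]])
qed (auto simp: id_in_U comp_in_U comp_assoc)

lemma U_eqI:
  assumes u: "u \<in> carrier U_grp" and s: "s \<in> carrier U_grp"
    and eq: "\<And>i. u (basis_V i) = s (basis_V i)"
  shows "u = s"
proof
  fix v
  obtain n where "v \<in> flag n"
    using ex_flag by blast
  then show "u v = s v"
    by (simp only: module_hom_expansion[OF carrier_U_module_hom[OF u]]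
        module_hom_expansion[OF carrier_U_module_hom[OF s]] eq)
qed

text \<open>
  The \<open>i\<close>-th coordinate of \<open>u e\<^sub>i\<close> is \<open>1\<close>, which excludes zero and every basis vector but \<open>e\<^sub>i\<close>.
\<close>

lemma unitriangular_basis_preserving_imp_id:
  assumes u: "u \<in> carrier U_grp"
    and basis: "\<And>i. u (basis_V i) \<in> {0} \<union> {basis_V k | k. True}"
  shows "u = id"
proof (rule U_eqI[OF u id_in_U])
  fix i
  have "u (basis_V i) - basis_V i \<in> flag i"
    using u by (intro unitriangularD basis_V_in_flag) (simp add: carrier_U_iff)
  then have "Poly_Mapping.lookup (u (basis_V i) - basis_V i) i = 0"
    by (simp add: flag_def)
  then have "Poly_Mapping.lookup (u (basis_V i)) i = 1"
    by (simp add: lookup_minus lookup_basis_V)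
  with basis[of i] show "u (basis_V i) = id (basis_V i)"
    by (auto simp: lookup_basis_V split: if_splits)
qed

section \<open>Cardinalities of the groups\<close>

text \<open>
  The nilpotent part of a block-diagonal matrix: the \<open>k\<close>-th block acts on the plane spanned by
  \<open>e\<^sub>2\<^sub>k\<close> and \<open>e\<^sub>2\<^sub>k\<^sub>+\<^sub>1\<close>, and sends \<open>e\<^sub>2\<^sub>k\<^sub>+\<^sub>1\<close> to \<open>e\<^sub>2\<^sub>k\<close> if \<open>k \<in> S\<close>.
\<close>

definition block_nilpotent :: "nat set \<Rightarrow> V \<Rightarrow> V" where
  "block_nilpotent S v = Poly_Mapping.Abs_poly_mapping
    (\<lambda>k. if even k \<and> k div 2 \<in> S then Poly_Mapping.lookup v (Suc k) else 0)"

definition block_unipotent :: "nat set \<Rightarrow> V \<Rightarrow> V" where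
  "block_unipotent S v = v + block_nilpotent S v"

lemma lookup_block_nilpotent:
  "Poly_Mapping.lookup (block_nilpotent S v) k =
    (if even k \<and> k div 2 \<in> S then Poly_Mapping.lookup v (Suc k) else 0)"
proof -
  let ?f = "\<lambda>k. if even k \<and> k div 2 \<in> S then Poly_Mapping.lookup v (Suc k) else 0"
  have "{k. ?f k \<noteq> 0} \<subseteq> Suc -` Poly_Mapping.keys v"
    by (auto simp: in_keys_iff)
  then have "finite {k. ?f k \<noteq> 0}"
    by (rule finite_subset) (simp add: finite_vimageI)
  then show ?thesis
    by (simp add: block_nilpotent_def lookup_Abs_poly_mapping)
qed

lemma lookup_block_unipotent:
  "Poly_Mapping.lookup (block_unipotent S v) k = Poly_Mapping.lookup v k +
    (if even k \<and> k div 2 \<in> S then Poly_Mapping.lookup v (Suc k) else 0)"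
  by (simp add: block_unipotent_def lookup_add lookup_block_nilpotent)

text \<open>
  Invertibility is free: \<open>1 + N\<close> is an involution in characteristic two when \<open>N \<circ> N = 0\<close>.
\<close>

lemma block_unipotent_in_U: "block_unipotent S \<in> carrier U_grp"
proof -
  have "block_unipotent S (block_unipotent S v) = v" for v
  proof (rule poly_mapping_eqI)
    fix k
    show "Poly_Mapping.lookup (block_unipotent S (block_unipotent S v)) k = Poly_Mapping.lookup v k"
      by (cases "Poly_Mapping.lookup v k"; cases "Poly_Mapping.lookup v (Suc k)")
        (simp_all add: lookup_block_unipotent)
  qed
  then have "bij (block_unipotent S)"
    by (intro o_bij[of "block_unipotent S"]) auto
  moreover have "Vector_Spaces.linear scale_V scale_V (block_unipotent S)"
    unfolding linear_V_iff
    by (auto intro!: poly_mapping_eqI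
        simp: lookup_block_unipotent lookup_add lookup_scale_V algebra_simps)
  moreover have "unitriangular (block_unipotent S)"
    by (auto simp: unitriangular_def flag_def lookup_minus lookup_block_unipotent)
  ultimately show ?thesis
    by (simp add: carrier_U_iff)
qed

lemma inj_block_unipotent: "inj block_unipotent"
proof (rule injI)
  fix S T assume eq: "block_unipotent S = block_unipotent T"
  have "Poly_Mapping.lookup (block_unipotent R (basis_V (Suc (2 * k)))) (2 * k) =
      of_bool (k \<in> R)" for R k
    by (simp add: lookup_block_unipotent lookup_basis_V)
  with eq have "of_bool (k \<in> S) = (of_bool (k \<in> T) :: bit)" for k
    by metis
  then show "S = T"
    by (auto simp: of_bool_eq_iff)
qed

lemma nat_sets_lepoll_U: "(UNIV :: nat set set) \<lesssim> carrier U_grp"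
  unfolding lepoll_def using inj_block_unipotent block_unipotent_in_U by blast

lemma carrier_G: "carrier G_grp = UNIV \<times> carrier U_grp"
  by (simp add: G_grp_def)

lemma U_lepoll_G: "carrier U_grp \<lesssim> carrier G_grp"
  unfolding lepoll_def carrier_G
  by (rule exI[of _ "\<lambda>u. (0, u)"]) (auto simp: inj_on_def)

text \<open>
  An element of \<open>G\<close> is sent to the sequence of vectors that determines it, and a sequence to the
  graph of its coded values.
\<close>

lemma G_lepoll_nat_sets: "carrier G_grp \<lesssim> (UNIV :: nat set set)"
proof -
  let ?seq = "\<lambda>(v :: V, u :: V \<Rightarrow> V). case_nat v (\<lambda>i. u (basis_V i))"
  have "inj_on ?seq (carrier G_grp)"
  proof (rule inj_onI)
    fix x y assume x: "x \<in> carrier G_grp" and y: "y \<in> carrier G_grp" and eq: "?seq x = ?seq y"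
    from eq have "?seq x 0 = ?seq y 0" "?seq x (Suc i) = ?seq y (Suc i)" for i
      by simp_all
    with x y show "x = y"
      by (auto simp: carrier_G intro: U_eqI)
  qed
  then have seq: "carrier G_grp \<lesssim> (UNIV :: (nat \<Rightarrow> V) set)"
    unfolding lepoll_def by blast
  let ?code = "\<lambda>v :: V. set_encode (Poly_Mapping.keys v)"
  let ?graph = "\<lambda>f :: nat \<Rightarrow> V. range (\<lambda>i. prod_encode (i, ?code (f i)))"
  have "inj ?graph"
  proof (rule injI, rule ext)
    fix f g i assume "?graph f = ?graph g"
    then have "prod_encode (i, ?code (f i)) \<in> ?graph g"
      by blast
    then have "?code (f i) = ?code (g i)"
      by auto
    then show "f i = g i"
      by (rule injD[OF inj_set_encode_keys])
  qed
  then have "(UNIV :: (nat \<Rightarrow> V) set) \<lesssim> (UNIV :: nat set set)"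
    unfolding lepoll_def by blast
  with seq show ?thesis
    by (rule lepoll_trans)
qed

lemma U_eqpoll_nat_sets: "carrier U_grp \<approx> (UNIV :: nat set set)"
  and G_eqpoll_nat_sets: "carrier G_grp \<approx> (UNIV :: nat set set)"
  using nat_sets_lepoll_U U_lepoll_G G_lepoll_nat_sets
  by (meson lepoll_antisym lepoll_trans)+

lemma nat_lesspoll_G: "(UNIV :: nat set) \<prec> carrier G_grp"
  using lesspoll_Pow_self[of "UNIV :: nat set"] eqpoll_sym[OF G_eqpoll_nat_sets]
  by (auto intro: lesspoll_eq_trans)

section \<open>The sets A and B\<close>

lemma A_B_disjoint: "A_set \<inter> B_set = {}"
  by (auto simp: A_set_def B_set_def)

lemma A_eqpoll_nat: "A_set \<approx> (UNIV :: nat set)"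
proof -
  have range: "A_set = range (\<lambda>i. (basis_V i, id))"
    unfolding A_set_def one_U by blast
  have "inj (\<lambda>i. (basis_V i, id :: V \<Rightarrow> V))"
    using inj_basis_V by (simp add: inj_def)
  then show ?thesis
    unfolding range by (rule inj_on_image_eqpoll_self)
qed

lemma V_id_eqpoll_nat: "(UNIV :: V set) \<times> {id :: V \<Rightarrow> V} \<approx> (UNIV :: nat set)"
proof -
  have range: "(UNIV :: V set) \<times> {id :: V \<Rightarrow> V} = range (\<lambda>v. (v, id))"
    by auto
  have "inj (\<lambda>v :: V. (v, id :: V \<Rightarrow> V))"
    by (simp add: inj_def)
  then have "(UNIV :: V set) \<times> {id :: V \<Rightarrow> V} \<approx> (UNIV :: V set)"
    unfolding range by (rule inj_on_image_eqpoll_self)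
  then show ?thesis
    using V_eqpoll_nat by (rule eqpoll_trans)
qed

lemma B_eqpoll_nat: "B_set \<approx> (UNIV :: nat set)"
proof (rule lepoll_antisym)
  have "B_set \<subseteq> UNIV \<times> {id}"
    by (auto simp: B_set_def)
  then show "B_set \<lesssim> (UNIV :: nat set)"
    using V_id_eqpoll_nat by (meson subset_imp_lepoll eqpoll_imp_lepoll lepoll_trans)
  let ?f = "\<lambda>i. (basis_V 0 + basis_V (Suc i), id :: V \<Rightarrow> V)"
  have "inj ?f"
    using inj_basis_V by (auto simp: inj_def)
  moreover have "basis_V 0 + basis_V (Suc i) \<notin> {0} \<union> {basis_V k | k. True}" for i
    by (rule two_coordinates_not_basis_V[of _ 0 "Suc i"])
      (simp_all add: lookup_add lookup_basis_V)
  then have "range ?f \<subseteq> B_set"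
    by (auto simp: B_set_def)
  ultimately show "(UNIV :: nat set) \<lesssim> B_set"
    unfolding lepoll_def by blast
qed

section \<open>Two-sided translates of A\<close>

lemma group_G: "group G_grp"
  by (rule group_G_grp[OF group_U])

lemma one_G [simp]: "\<one>\<^bsub>G_grp\<^esub> = (0, id)"
  and mult_G [simp]: "(v, u) \<otimes>\<^bsub>G_grp\<^esub> (w, s) = (v + u w, u \<circ> s)"
  by (simp_all add: G_grp_def)

lemma inv_G_translation: "inv\<^bsub>G_grp\<^esub> (v, id) = (v, id)"
  by (rule group.inv_equality[OF group_G]) (simp_all add: carrier_G id_in_U)

lemma translates_disjoint_iff:
  "(X <#>\<^bsub>G_grp\<^esub> A_set <#>\<^bsub>G_grp\<^esub> Y) \<inter> B_set = {} \<longleftrightarrow>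
    (\<forall>x\<in>X. \<forall>y\<in>Y. \<forall>i. x \<otimes>\<^bsub>G_grp\<^esub> (basis_V i, id) \<otimes>\<^bsub>G_grp\<^esub> y \<notin> B_set)"
  by (fastforce simp: set_mult_def A_set_def)

lemma conjugate_basis_V:
  assumes "(v, u) \<in> carrier G_grp"
  shows "(v, u) \<otimes>\<^bsub>G_grp\<^esub> (basis_V i, id) \<otimes>\<^bsub>G_grp\<^esub> inv\<^bsub>G_grp\<^esub> (v, u) = (u (basis_V i), id)"
proof -
  obtain w s where ws: "inv\<^bsub>G_grp\<^esub> (v, u) = (w, s)"
    by fastforce
  with group.r_inv[OF group_G assms] have "v + u w = 0" "u \<circ> s = id"
    by simp_all
  moreover have "v + u (basis_V i) + u w = (v + u w) + u (basis_V i)"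
    by (simp add: ac_simps)
  ultimately show ?thesis
    by (simp add: ws)
qed

text \<open>
  Conjugation cancels the translation part \<open>v\<close>, so disjointness from \<open>B\<close> becomes a condition on
  the images \<open>u e\<^sub>i\<close> alone.
\<close>

lemma conjugates_disjoint_imp_translation:
  assumes x: "(v, u) \<in> carrier G_grp"
    and conj: "\<And>i. (v, u) \<otimes>\<^bsub>G_grp\<^esub> (basis_V i, id) \<otimes>\<^bsub>G_grp\<^esub> inv\<^bsub>G_grp\<^esub> (v, u) \<notin> B_set"
  shows "u = id"
proof (rule unitriangular_basis_preserving_imp_id)
  show "u \<in> carrier U_grp"
    using x by (simp add: carrier_G)
  show "u (basis_V i) \<in> {0} \<union> {basis_V k | k. True}" for i
    using conj[of i] unfolding conjugate_basis_V[OF x] by (auto simp: B_set_def)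
qed

lemma W_set_eq: "W_set G_grp A_set B_set = UNIV \<times> {id}"
proof (intro equalityI subsetI)
  fix x assume x: "x \<in> W_set G_grp A_set B_set"
  obtain v u where vu: "x = (v, u)"
    by fastforce
  have "u = id"
    using x unfolding vu
    by (intro conjugates_disjoint_imp_translation[of v]) (auto simp: W_set_def translates_disjoint_iff)
  with vu show "x \<in> UNIV \<times> {id}"
    by simp
next
  fix x :: "V \<times> (V \<Rightarrow> V)" assume "x \<in> UNIV \<times> {id}"
  then obtain v where v: "x = (v, id)"
    by auto
  have "v + basis_V i + v = basis_V i" for i
    by (simp add: add.commute[of v] add.assoc)
  then have "({x, inv\<^bsub>G_grp\<^esub> x} <#>\<^bsub>G_grp\<^esub> A_set <#>\<^bsub>G_grp\<^esub> {x, inv\<^bsub>G_grp\<^esub> x}) \<inter> B_set = {}"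
    unfolding translates_disjoint_iff by (auto simp: v inv_G_translation B_set_def)
  then show "x \<in> W_set G_grp A_set B_set"
    unfolding W_set_def by (simp add: v carrier_G id_in_U)
qed

lemma symmetric_disjoint_imp_trivial:
  assumes X: "X \<subseteq> carrier G_grp" and one: "\<one>\<^bsub>G_grp\<^esub> \<in> X" and sym: "X = set_inv\<^bsub>G_grp\<^esub> X"
    and disj: "(X <#>\<^bsub>G_grp\<^esub> A_set <#>\<^bsub>G_grp\<^esub> X) \<inter> B_set = {}"
  shows "X = {\<one>\<^bsub>G_grp\<^esub>}"
proof -
  have "x = \<one>\<^bsub>G_grp\<^esub>" if x: "x \<in> X" for x
  proof -
    obtain v u where vu: "x = (v, u)"
      by fastforce
    have inv: "inv\<^bsub>G_grp\<^esub> x \<in> X"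
      using x by (subst sym) (auto simp: SET_INV_def)
    have u: "u = id"
    proof (rule conjugates_disjoint_imp_translation)
      show "(v, u) \<in> carrier G_grp"
        using x X vu by auto
      show "(v, u) \<otimes>\<^bsub>G_grp\<^esub> (basis_V i, id) \<otimes>\<^bsub>G_grp\<^esub> inv\<^bsub>G_grp\<^esub> (v, u) \<notin> B_set" for i
        using disj x inv vu unfolding translates_disjoint_iff by blast
    qed
    have "\<one>\<^bsub>G_grp\<^esub> \<otimes>\<^bsub>G_grp\<^esub> (basis_V i, id) \<otimes>\<^bsub>G_grp\<^esub> x \<notin> B_set" for i
      using disj one x unfolding translates_disjoint_iff by blast
    then have "basis_V i + v \<in> {0} \<union> {basis_V k | k. True}" for i
      by (auto simp: vu u B_set_def)
    with ex_basis_translate_outside[of v] have "v = 0"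
      by blast
    with vu u show ?thesis
      by simp
  qed
  with one show ?thesis
    by blast
qed

lemma not_separable: "\<not> separable G_grp A_set B_set"
proof
  assume "separable G_grp A_set B_set"
  then obtain X where "infinite X" "X = {\<one>\<^bsub>G_grp\<^esub>}"
    unfolding separable_def using symmetric_disjoint_imp_trivial by blast
  then show False
    by (metis finite.emptyI finite.insertI)
qed

theorem proposition6p2:
  shows
    "(group U_grp \<and>
      carrier U_grp \<approx> (UNIV :: nat set set) \<and>
      carrier G_grp \<approx> (UNIV :: nat set set)) \<and>
     (A_set \<inter> B_set = {} \<and>
      A_set \<approx> (UNIV :: nat set) \<and>
      B_set \<approx> (UNIV :: nat set) \<and>
      (UNIV :: nat set) \<prec> carrier G_grp) \<and>
     (W_set G_grp A_set B_set = UNIV \<times> {\<one>\<^bsub>U_grp\<^esub>} \<and>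
      W_set G_grp A_set B_set \<approx> (UNIV :: nat set)) \<and>
     ((\<forall>X \<subseteq> carrier G_grp.
         \<one>\<^bsub>G_grp\<^esub> \<in> X \<longrightarrow> X = set_inv\<^bsub>G_grp\<^esub> X \<longrightarrow>
         (X <#>\<^bsub>G_grp\<^esub> A_set <#>\<^bsub>G_grp\<^esub> X) \<inter> B_set = {} \<longrightarrow>
         X = {\<one>\<^bsub>G_grp\<^esub>}) \<and>
      \<not> separable G_grp A_set B_set)"
  using group_U U_eqpoll_nat_sets G_eqpoll_nat_sets A_B_disjoint A_eqpoll_nat B_eqpoll_nat
    nat_lesspoll_G W_set_eq V_id_eqpoll_nat not_separable
  by (intro conjI allI impI symmetric_disjoint_imp_trivial) simp_all

end
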